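(* Let $p\neq 2$ be a prime, let $n\geqslant 1$ be an integer, let $f(x)=x^{p-1}+x^{p-2}+\cdots+x+1\in\mathbb{F}_2[x]$, and let $f_i(x)$ be an irreducible factor of $f(x)$ over $\mathbb{F}_2$. For integers $N\geqslant 1$ and $0\leqslant r\leqslant N-1$ let $\mathcal{C}_{p^N,\,r}$ denote the binary cyclic code of length $p^N$ with generator polynomial $f_i(x^{p^r})$. Then for every integer $m$ with $1\leqslant m\leqslant n-1$, the full automorphism group $\mathrm{Aut}\,\mathcal{C}_{p^n,\,m}$ is isomorphic to $$(\mathrm{Aut}\,\mathcal{C}_{p^{n-m},\,0})^{p^m} : \mathrm{S}_{p^m},$$ where $\mathrm{Aut}\,\mathcal{C}_{p^{n-m},\,0}$ is the full automorphism group of $\mathcal{C}_{p^{n-m},\,0}$.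
   Context: All polynomials are over $\mathbb{F}_2$. One has $x^{p^N}-1=(x+1)f(x)f(x^p)\cdots f(x^{p^{N-1}})$, so $f_i(x^{p^r})$ divides $x^{p^N}-1$ for $0\leqslant r\leqslant N-1$. For $h(x)\in\mathbb{F}_2[x]$ dividing $x^L-1$, the binary cyclic code of length $L$ with generator polynomial $h$ is the set of all $(c_0,\dots,c_{L-1})\in\mathbb{F}_2^L$ such that $c_0+c_1x+\cdots+c_{L-1}x^{L-1}$ lies in the ideal generated by $h$ in $\mathbb{F}_2[x]/(x^L-1)$. For a code $\mathcal{C}$ of length $L$, an automorphism of $\mathcal{C}$ is a permutation of the $L$ coordinate positions that maps each codeword of $\mathcal{C}$ to a codeword of $\mathcal{C}$; the full automorphism group $\mathrm{Aut}\,\mathcal{C}\leqslant \mathrm{S}_L$ is the group of all of these under composition. $\mathrm{S}_k$ is the symmetric group of degree $k$, $A^k$ is the direct product of $k$ copies of $A$, and $A:B$ denotes a semidirect product (split extension) with normal subgroup $A$ and complement $B$. *)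

theory Defs
  imports
    "HOL-Library.Z2"
    "HOL-Computational_Algebra.Computational_Algebra"
    "HOL-Algebra.Product_Groups"
    "HOL-Algebra.Sym_Groups"
begin

text \<open>
  The field with two elements is \<^typ>\<open>bit\<close>. Words of length \<open>L\<close> are functions on the
  positions \<open>{0..<L}\<close>, extended by \<open>undefined\<close>, so that equality of words is equality on
  the positions.
\<close>

definition word_poly :: "nat \<Rightarrow> (nat \<Rightarrow> bit) \<Rightarrow> bit poly" where
  "word_poly L c = (\<Sum>i<L. monom (c i) i)"

text \<open>
  The class of \<open>c(x)\<close> lies in the ideal generated by \<open>h\<close> in the quotient by
  \<open>x^L - 1\<close> iff it is the class of some multiple \<open>q h\<close>.
\<close>

definition cyclic_code :: "nat \<Rightarrow> bit poly \<Rightarrow> (nat \<Rightarrow> bit) set" where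
  "cyclic_code L h =
     {c \<in> {..<L} \<rightarrow>\<^sub>E UNIV. \<exists>q. (monom 1 L - 1) dvd (word_poly L c - q * h)}"

text \<open>
  Moving the entry at position \<open>i\<close> to position \<open>\<sigma> i\<close>.
\<close>

definition permute_positions :: "(nat \<Rightarrow> nat) \<Rightarrow> (nat \<Rightarrow> 'a) \<Rightarrow> (nat \<Rightarrow> 'a)" where
  "permute_positions \<sigma> c = (\<lambda>i. c (inv' \<sigma> i))"

definition Aut_code :: "nat \<Rightarrow> (nat \<Rightarrow> bit) set \<Rightarrow> (nat \<Rightarrow> nat) monoid" where
  "Aut_code L C =
     \<lparr>carrier = {\<sigma>. \<sigma> permutes {..<L} \<and> (\<forall>c\<in>C. permute_positions \<sigma> c \<in> C)},
      mult = (\<circ>), one = id\<rparr>"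

definition semidirect_product ::
  "('a, 'c) monoid_scheme \<Rightarrow> ('b, 'd) monoid_scheme \<Rightarrow> ('b \<Rightarrow> 'a \<Rightarrow> 'a) \<Rightarrow> ('a \<times> 'b) monoid" where
  "semidirect_product A B \<phi> =
     \<lparr>carrier = carrier A \<times> carrier B,
      mult = (\<lambda>(a, b) (a', b'). (a \<otimes>\<^bsub>A\<^esub> \<phi> b a', b \<otimes>\<^bsub>B\<^esub> b')),
      one = (\<one>\<^bsub>A\<^esub>, \<one>\<^bsub>B\<^esub>)\<rparr>"

text \<open>
  \<open>A^k : S_k\<close>, where \<open>S_k\<close> acts on \<open>A^k\<close> by permuting the \<open>k\<close> factors
  (the factor at position \<open>i\<close> moves to position \<open>\<sigma> i\<close>).
\<close>

definition power_semidirect_sym ::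
  "('a, 'c) monoid_scheme \<Rightarrow> nat \<Rightarrow> ((nat \<Rightarrow> 'a) \<times> (nat \<Rightarrow> nat)) monoid" where
  "power_semidirect_sym A k =
     semidirect_product (product_group {1..k} (\<lambda>_. A)) (sym_group k) permute_positions"

text \<open>
  For \<open>g\<close> an irreducible factor of \<open>x^(p-1) + ... + x + 1\<close>, this is the code of length
  \<open>p^N\<close> with generator polynomial \<open>g(x^(p^r))\<close>.
\<close>

definition code_C :: "bit poly \<Rightarrow> nat \<Rightarrow> nat \<Rightarrow> nat \<Rightarrow> (nat \<Rightarrow> bit) set" where
  "code_C g p N r = cyclic_code (p ^ N) (pcompose g (monom 1 (p ^ r)))"

end

theory Submission
  imports Defs
begin

text \<open>
  Put \<open>k = p^m\<close>. The code of length \<open>p^n\<close> generated by \<open>g(x^k)\<close> consists of \<open>k\<close>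
  independent codewords of the code generated by \<open>g\<close> in length \<open>p^(n - m)\<close>, one on each
  residue class of positions modulo \<open>k\<close>. This makes the wreath product act. Conversely, an
  automorphism preserves the family of sets \<open>S\<close> of positions such that setting the entries
  outside \<open>S\<close> to zero maps the code into itself. Residue classes modulo \<open>k\<close> are such sets.
  Every such \<open>S\<close> is a union of residue classes: the property is stable under Boolean operations
  and under translation, and if no step \<open>r k\<close> with \<open>0 < r < p\<close> were a common period of
  all these sets, some intersection of them would meet the support of \<open>g(x^k)\<close> in the single
  position \<open>0\<close>, so that a unit would belong to the code. As \<open>k p\<close> is a common period and
  \<open>p\<close> is prime, \<open>k\<close> is one as well. Hence automorphisms permute the residue classes.
\<close>

section \<open>Multisection of polynomials\<close>

text \<open>For \<open>j < k\<close> this collects the coefficients at exponents congruent to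
  \<open>j\<close> modulo \<open>k\<close>. The list ends at \<open>degree q\<close>, which is long
  enough when \<open>0 < k\<close> because \<open>t \<le> k * t + j\<close>.\<close>

definition multisect :: "nat \<Rightarrow> nat \<Rightarrow> 'a::zero poly \<Rightarrow> 'a poly" where
  "multisect k j q = Poly (map (\<lambda>t. coeff q (k * t + j)) [0..<Suc (degree q)])"

lemma coeff_multisect:
  assumes "0 < k"
  shows "coeff (multisect k j q) t = coeff q (k * t + j)"
proof (cases "t \<le> degree q")
  case True
  then show ?thesis
    by (simp add: multisect_def nth_default_def del: upt_Suc)
next
  case False
  moreover have "t \<le> k * t"
    using assms by simp
  ultimately have "degree q < k * t + j"
    by linarith
  then show ?thesis
    using False by (simp add: multisect_def nth_default_def coeff_eq_0 del: upt_Suc)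
qed

lemma coeff_pcompose_monom:
  fixes a :: "'a::comm_semiring_1 poly"
  assumes "0 < k"
  shows "coeff (pcompose a (monom 1 k)) i = (if k dvd i then coeff a (i div k) else 0)"
proof (induction a arbitrary: i)
  case 0
  then show ?case by simp
next
  case (pCons b a)
  show ?case
  proof (cases "i < k")
    case True
    then show ?thesis
      using assms by (auto simp: pcompose_pCons coeff_monom_mult coeff_pCons split: nat.splits
          dest: dvd_imp_le)
  next
    case False
    then have "k dvd i \<longleftrightarrow> k dvd i - k" and "i div k = Suc ((i - k) div k)"
      using assms by (simp_all add: dvd_minus_self le_div_geq)
    then show ?thesis
      using False assms pCons.IH by (auto simp: pcompose_pCons coeff_monom_mult coeff_pCons
          split: nat.splits)
  qed
qed

text \<open>Multiplying by a polynomial in \<open>x^k\<close> moves exponents by multiples of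
  \<open>k\<close> only, so it never mixes sections.\<close>

lemma multisect_mult_pcompose:
  fixes g :: "'a::comm_semiring_1 poly"
  assumes "j < k"
  shows "multisect k j (q * pcompose g (monom 1 k)) = multisect k j q * g"
proof (induction g)
  case 0
  then show ?case
    using assms by (intro poly_eqI) (simp add: coeff_multisect)
next
  case (pCons b g)
  have "multisect k j (q * pcompose (pCons b g) (monom 1 k)) =
      smult b (multisect k j q) + pCons 0 (multisect k j (q * pcompose g (monom 1 k)))"
  proof (rule poly_eqI)
    fix t
    have eq: "q * pcompose (pCons b g) (monom 1 k) =
        smult b q + monom 1 k * (q * pcompose g (monom 1 k))"
      by (simp add: pcompose_pCons algebra_simps)
    show "coeff (multisect k j (q * pcompose (pCons b g) (monom 1 k))) t =
        coeff (smult b (multisect k j q) + pCons 0 (multisect k j (q * pcompose g (monom 1 k)))) t"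
      unfolding eq using assms
      by (cases t) (simp_all add: coeff_multisect coeff_monom_mult add.assoc)
  qed
  then show ?case
    by (simp add: pCons.IH)
qed

lemma sum_multisect:
  fixes w :: "'a::comm_semiring_1 poly"
  assumes "0 < k"
  shows "w = (\<Sum>j<k. monom 1 j * pcompose (multisect k j w) (monom 1 k))"
proof (rule poly_eqI)
  fix i
  have summand: "coeff (monom 1 j * pcompose (multisect k j w) (monom 1 k)) i =
      (if j = i mod k then coeff w i else 0)" if "j < k" for j
  proof (cases "j \<le> i")
    case True
    then have "k dvd i - j \<longleftrightarrow> i mod k = j mod k"
      using mod_eq_dvd_iff_nat by metis
    moreover have "k * ((i - j) div k) + j = i" if "k dvd i - j"
      using True that by simp
    ultimately show ?thesis
      using True \<open>j < k\<close> assms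
      by (auto simp: coeff_monom_mult coeff_pcompose_monom coeff_multisect)
  next
    case False
    then show ?thesis
      using \<open>j < k\<close> by (auto simp: coeff_monom_mult not_le)
  qed
  have "coeff (\<Sum>j<k. monom 1 j * pcompose (multisect k j w) (monom 1 k)) i =
      (\<Sum>j<k. if j = i mod k then coeff w i else 0)"
    unfolding coeff_sum by (intro sum.cong) (auto simp: summand)
  also have "\<dots> = coeff w i"
    using assms by (subst sum.delta) auto
  finally show "coeff w i =
      coeff (\<Sum>j<k. monom 1 j * pcompose (multisect k j w) (monom 1 k)) i"
    by simp
qed

text \<open>Polynomials form a free module over the polynomials in \<open>x^k\<close> with basis
  \<open>1, x, ..., x^(k-1)\<close>, so divisibility by an element of that subring can be tested on
  coordinates.\<close>

lemma pcompose_dvd_iff_multisect: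
  fixes g w :: "'a::comm_ring_1 poly"
  assumes "0 < k"
  shows "pcompose g (monom 1 k) dvd w \<longleftrightarrow> (\<forall>j<k. g dvd multisect k j w)"
proof
  assume "pcompose g (monom 1 k) dvd w"
  then obtain q where "w = q * pcompose g (monom 1 k)"
    by (metis dvdE mult.commute)
  then show "\<forall>j<k. g dvd multisect k j w"
    by (simp add: multisect_mult_pcompose)
next
  assume *: "\<forall>j<k. g dvd multisect k j w"
  have "pcompose g (monom 1 k) dvd pcompose (multisect k j w) (monom 1 k)" if "j < k" for j
    using * that by (metis dvdE dvd_triv_left pcompose_mult)
  then show "pcompose g (monom 1 k) dvd w"
    by (subst sum_multisect[OF assms, of w]) (auto intro!: dvd_sum dvd_mult)
qed

lemma pcompose_dvd_monom_diff_1: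
  fixes g :: "'a::comm_ring_1 poly"
  assumes "0 < k" and "g dvd monom 1 M - 1"
  shows "pcompose g (monom 1 k) dvd monom 1 (k * M) - 1"
proof -
  have "pcompose (monom 1 M - 1) (monom 1 k) = (monom 1 (k * M) - 1 :: 'a poly)"
    using assms(1) by (intro poly_eqI)
      (auto simp: pcompose_diff pcompose_1 coeff_pcompose_monom, metis dvd_triv_left)
  then show ?thesis
    using assms(2) by (metis dvdE dvd_triv_left pcompose_mult)
qed

lemma monom_diff_1_dvd: "monom 1 L - 1 dvd (monom 1 (L * i) - 1 :: 'a::comm_ring_1 poly)"
proof -
  have "monom 1 L - 1 dvd (monom 1 L) ^ i - (1 :: 'a poly)"
    by (metis dvd_triv_left power_diff_1_eq)
  then show ?thesis
    by (simp add: monom_power)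
qed

section \<open>Cyclic codes and interleaving\<close>

lemma coeff_word_poly: "coeff (word_poly L c) i = (if i < L then c i else 0)"
  by (simp add: word_poly_def coeff_sum)

text \<open>As \<open>h\<close> divides \<open>x^L - 1\<close>, passing to the quotient ring leaves
  divisibility by \<open>h\<close> unchanged.\<close>

lemma mem_cyclic_code_iff:
  assumes "h dvd monom 1 L - 1"
  shows "c \<in> cyclic_code L h \<longleftrightarrow> c \<in> {..<L} \<rightarrow>\<^sub>E UNIV \<and> h dvd word_poly L c"
proof -
  have "(\<exists>q. (monom 1 L - 1) dvd (word_poly L c - q * h)) \<longleftrightarrow> h dvd word_poly L c"
  proof
    assume "\<exists>q. (monom 1 L - 1) dvd (word_poly L c - q * h)"
    then obtain q where "h dvd word_poly L c - q * h"
      using assms dvd_trans by blast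
    then show "h dvd word_poly L c"
      by (metis diff_add_cancel dvd_add dvd_triv_right)
  next
    assume "h dvd word_poly L c"
    then obtain q where "word_poly L c = q * h"
      by (metis dvdE mult.commute)
    then have "word_poly L c - q * h = 0"
      by simp
    then show "\<exists>q. (monom 1 L - 1) dvd (word_poly L c - q * h)"
      by (metis dvd_0_right)
  qed
  then show ?thesis
    by (simp add: cyclic_code_def)
qed

definition strand :: "nat \<Rightarrow> nat \<Rightarrow> (nat \<Rightarrow> 'a) \<Rightarrow> nat \<Rightarrow> nat \<Rightarrow> 'a" where
  "strand k M c j = restrict (\<lambda>t. c (k * t + j)) {..<M}"

definition interleave :: "nat \<Rightarrow> nat \<Rightarrow> (nat \<Rightarrow> 'a) set \<Rightarrow> (nat \<Rightarrow> 'a) set" where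
  "interleave k M D = {c \<in> {..<k * M} \<rightarrow>\<^sub>E UNIV. \<forall>j<k. strand k M c j \<in> D}"

lemma interleaved_index_less:
  fixes k M t j :: nat
  assumes "j < k"
  shows "k * t + j < k * M \<longleftrightarrow> t < M"
proof
  assume "t < M"
  then have "k * Suc t \<le> k * M"
    by (intro mult_le_mono2) simp
  with assms show "k * t + j < k * M"
    by simp
next
  assume "k * t + j < k * M"
  then have "k * t < k * M"
    by linarith
  then show "t < M"
    by simp
qed

lemma multisect_word_poly:
  assumes "j < k"
  shows "multisect k j (word_poly (k * M) c) = word_poly M (strand k M c j)"
  using assms
  by (intro poly_eqI) (simp add: coeff_multisect coeff_word_poly strand_def interleaved_index_less)

text \<open>The coordinates of a word polynomial over the polynomials in \<open>x^k\<close> are the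
  polynomials of its strands, so the divisibility test becomes a condition on each strand
  alone.\<close>

lemma cyclic_code_pcompose:
  assumes "0 < k" and "g dvd monom 1 M - 1"
  shows "cyclic_code (k * M) (pcompose g (monom 1 k)) = interleave k M (cyclic_code M g)"
proof -
  note dvd = pcompose_dvd_monom_diff_1[OF assms]
  show ?thesis
    by (auto simp: interleave_def mem_cyclic_code_iff[OF dvd] mem_cyclic_code_iff[OF assms(2)]
        pcompose_dvd_iff_multisect[OF assms(1)] multisect_word_poly strand_def)
qed

section \<open>Separating sets of positions\<close>

definition filter_poly :: "(nat \<Rightarrow> bool) \<Rightarrow> 'a::zero poly \<Rightarrow> 'a poly" where
  "filter_poly Q q = Poly (map (\<lambda>i. if Q i then coeff q i else 0) [0..<Suc (degree q)])"

lemma coeff_filter_poly: "coeff (filter_poly Q q) i = (if Q i then coeff q i else 0)"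
  by (cases "i \<le> degree q")
    (simp_all add: filter_poly_def nth_default_def coeff_eq_0 del: upt_Suc)

text \<open>Stated for all polynomials rather than for words of a fixed length, so that positions
  can be translated without wrapping around.\<close>

definition separating :: "'a::comm_semiring_1 poly \<Rightarrow> (nat \<Rightarrow> bool) \<Rightarrow> bool" where
  "separating h Q \<longleftrightarrow> (\<forall>q. h dvd q \<longrightarrow> h dvd filter_poly Q q)"

lemma separating_Not:
  fixes h :: "'a::comm_ring_1 poly"
  assumes "separating h Q"
  shows "separating h (\<lambda>i. \<not> Q i)"
proof -
  have "filter_poly (\<lambda>i. \<not> Q i) q = q - filter_poly Q q" for q :: "'a poly"
    by (rule poly_eqI) (simp add: coeff_filter_poly)
  with assms show ?thesis
    by (simp add: separating_def)
qed

lemma separating_conj: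
  fixes h :: "'a::comm_semiring_1 poly"
  assumes "separating h Q" and "separating h R"
  shows "separating h (\<lambda>i. Q i \<and> R i)"
proof -
  have "filter_poly (\<lambda>i. Q i \<and> R i) q = filter_poly Q (filter_poly R q)" for q :: "'a poly"
    by (rule poly_eqI) (simp add: coeff_filter_poly)
  with assms show ?thesis
    by (simp add: separating_def)
qed

lemma separating_Ball:
  fixes h :: "'a::comm_semiring_1 poly"
  assumes "finite H" and "\<And>s. s \<in> H \<Longrightarrow> separating h (Q s)"
  shows "separating h (\<lambda>i. \<forall>s\<in>H. Q s i)"
  using assms
proof (induction H rule: finite_induct)
  case empty
  have "filter_poly (\<lambda>i. True) q = q" for q :: "'a poly"
    by (rule poly_eqI) (simp add: coeff_filter_poly)
  then show ?case
    by (simp add: separating_def)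
next
  case (insert s H)
  then show ?case
    using separating_conj[of h "Q s" "\<lambda>i. \<forall>s\<in>H. Q s i"] by simp
qed

text \<open>The divisibility makes \<open>x\<close> invertible modulo \<open>h\<close>; as
  \<open>h\<close> is moreover not a unit, no nonzero monomial lies in its ideal.\<close>

locale cyclic_generator =
  fixes h :: "'a::field poly" and L :: nat
  assumes length_pos: "0 < L"
    and generator_dvd: "h dvd monom 1 L - 1"
    and generator_not_unit: "\<not> h dvd 1"
begin

lemma dvd_monom_power: "h dvd monom 1 (L * i) - 1"
  using generator_dvd monom_diff_1_dvd by (rule dvd_trans)

text \<open>Modulo \<open>h\<close> the inverse of \<open>x^i\<close> is
  \<open>x^(L * i - i)\<close>, because \<open>x^(L * i)\<close> is congruent to
  \<open>1\<close>.\<close>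

lemma dvd_monom_mult_cancel:
  assumes "h dvd monom 1 i * q"
  shows "h dvd q"
proof -
  have "monom 1 (L * i) = (monom 1 (L * i - i) * monom 1 i :: 'a poly)"
    using length_pos by (simp add: mult_monom)
  with assms have "h dvd monom 1 (L * i) * q"
    by (simp add: mult.assoc)
  moreover have "h dvd (monom 1 (L * i) - 1) * q"
    using dvd_monom_power by simp
  ultimately have "h dvd monom 1 (L * i) * q - (monom 1 (L * i) - 1) * q"
    by (rule dvd_diff)
  then show ?thesis
    by (simp add: algebra_simps)
qed

lemma not_dvd_monom:
  assumes "c \<noteq> 0"
  shows "\<not> h dvd monom c i"
proof
  assume "h dvd monom c i"
  then have "h dvd smult c (monom 1 i * 1)"
    by (simp add: smult_monom)
  then show False
    using assms dvd_monom_mult_cancel generator_not_unit dvd_smult_cancel by metis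
qed

text \<open>Filtering \<open>x^s * q\<close> by \<open>Q\<close> gives \<open>x^s\<close> times the
  result of filtering \<open>q\<close> by the translate of \<open>Q\<close>, and \<open>x^s\<close>
  can be cancelled.\<close>

lemma separating_shift:
  assumes "separating h Q"
  shows "separating h (\<lambda>i. Q (i + s))"
  unfolding separating_def
proof (intro allI impI)
  fix q assume "h dvd q"
  have "monom 1 s * filter_poly (\<lambda>i. Q (i + s)) q = filter_poly Q (monom 1 s * q)"
    by (rule poly_eqI) (auto simp: coeff_monom_mult coeff_filter_poly)
  then show "h dvd filter_poly (\<lambda>i. Q (i + s)) q"
    using assms \<open>h dvd q\<close> dvd_monom_mult_cancel by (metis dvd_mult separating_def)
qed

text \<open>Filter the multiple \<open>x^i * (x^L - 1)\<close> of \<open>h\<close>: if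
  \<open>Q\<close> told \<open>i\<close> and \<open>i + L\<close> apart, exactly one of the two
  monomials would survive.\<close>

lemma separating_length:
  assumes "separating h Q"
  shows "Q (i + L) = Q i"
proof (rule ccontr)
  assume neq: "Q (i + L) \<noteq> Q i"
  have "h dvd filter_poly Q (monom 1 i * (monom 1 L - 1))"
    using assms generator_dvd by (simp add: separating_def)
  moreover have "monom 1 i * (monom 1 L - 1) = (monom 1 (i + L) - monom 1 i :: 'a poly)"
    by (simp add: right_diff_distrib mult_monom)
  then have "filter_poly Q (monom 1 i * (monom 1 L - 1)) =
      (if Q i then monom (- 1) i else monom 1 (i + L) :: 'a poly)"
    using neq length_pos by (intro poly_eqI) (auto simp: coeff_filter_poly)
  ultimately show False
    using not_dvd_monom by (simp split: if_splits)
qed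

text \<open>
  If \<open>0\<close> could be separated from every other element of the support of \<open>h\<close>, then
  intersecting the separating sets and applying the result to \<open>h\<close> itself would put the
  constant \<open>h(0)\<close> into the ideal.
\<close>

lemma separating_support:
  assumes "coeff h 0 \<noteq> 0"
  obtains s where "0 < s" and "coeff h s \<noteq> 0"
    and "\<And>Q i. separating h Q \<Longrightarrow> Q (i + s) = Q i"
proof -
  define H where "H = {s. 0 < s \<and> coeff h s \<noteq> 0}"
  have "finite H"
    by (rule finite_subset[of _ "{..degree h}"]) (auto simp: H_def le_degree)
  \<comment> \<open>One \<open>s\<close> has to serve all \<open>Q\<close> at once, because the
    translates of a given \<open>Q\<close> are inserted below.\<close>
  have "\<exists>s\<in>H. \<forall>Q. separating h Q \<longrightarrow> Q 0 = Q s"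
  proof (rule ccontr)
    assume "\<not> ?thesis"
    then have "\<forall>s\<in>H. \<exists>Q. separating h Q \<and> Q 0 \<and> \<not> Q s"
      using separating_Not by (metis (mono_tags, lifting))
    then obtain Q where Q: "\<And>s. s \<in> H \<Longrightarrow> separating h (Q s) \<and> Q s 0 \<and> \<not> Q s s"
      by metis
    then have "h dvd filter_poly (\<lambda>i. \<forall>s\<in>H. Q s i) h"
      using separating_Ball[OF \<open>finite H\<close>, of h Q] by (simp add: separating_def)
    moreover have "filter_poly (\<lambda>i. \<forall>s\<in>H. Q s i) h = monom (coeff h 0) 0"
      using Q by (intro poly_eqI) (auto simp: coeff_filter_poly H_def)
    ultimately show False
      using not_dvd_monom assms by metis
  qed
  then obtain s where "s \<in> H" and s: "\<And>Q. separating h Q \<Longrightarrow> Q 0 = Q s"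
    by blast
  have "Q (i + s) = Q i" if "separating h Q" for Q i
    using s[OF separating_shift[OF that, of i]] by (simp add: add.commute)
  then show thesis
    using \<open>s \<in> H\<close> by (intro that[of s]) (auto simp: H_def)
qed

end

lemma periodic_add_mult:
  fixes Q :: "nat \<Rightarrow> bool"
  assumes "\<And>i. Q (i + s) = Q i"
  shows "Q (i + a * s) = Q i"
proof (induction a)
  case (Suc a)
  have "i + Suc a * s = (i + a * s) + s"
    by simp
  then show ?case
    using assms Suc by metis
qed simp

text \<open>The support of \<open>g(x^k)\<close> yields a period \<open>k * r\<close> with
  \<open>0 < r < p\<close>, and \<open>k * p\<close> is another one. Since \<open>r\<close> is
  invertible modulo the prime \<open>p\<close>, the two combine to \<open>k\<close>.\<close>

lemma separating_pcompose_period: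
  fixes g :: "'a::field poly"
  assumes "prime p" and "0 < k" and "degree g < p" and "coeff g 0 \<noteq> 0" and "\<not> g dvd 1"
    and "g dvd monom 1 p - 1" and sep: "separating (pcompose g (monom 1 k)) Q"
  shows "Q (i + k) = Q i"
proof -
  let ?h = "pcompose g (monom 1 k)"
  \<comment> \<open>The ideal already contains \<open>x^(k * p) - 1\<close>, so the length
    \<open>k * p\<close> may be used whatever the length of the code.\<close>
  interpret cyclic_generator ?h "k * p"
  proof
    show "0 < k * p"
      using assms(1,2) by (simp add: prime_gt_0_nat)
    show "?h dvd monom 1 (k * p) - 1"
      using assms(2,6) by (rule pcompose_dvd_monom_diff_1)
    show "\<not> ?h dvd 1"
    proof
      assume "?h dvd 1"
      then have "g dvd multisect k 0 1"
        using pcompose_dvd_iff_multisect[OF assms(2)] assms(2) by blast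
      moreover have "multisect k 0 1 = (1 :: 'a poly)"
        using assms(2) by (intro poly_eqI) (simp add: coeff_multisect)
      ultimately show False
        using assms(5) by simp
    qed
  qed
  have "coeff ?h 0 \<noteq> 0"
    using assms(2,4) by (subst coeff_pcompose_monom) simp_all
  then obtain s where "0 < s" "coeff ?h s \<noteq> 0" and s: "\<And>Q i. separating ?h Q \<Longrightarrow> Q (i + s) = Q i"
    using separating_support by blast
  then obtain r where r: "s = k * r" "coeff g r \<noteq> 0"
    using assms(2) by (auto simp: coeff_pcompose_monom split: if_splits)
  then have "0 < r" "r < p"
    using \<open>0 < s\<close> assms(3) le_degree by force+
  then have "coprime p r"
    using assms(1) by (intro prime_imp_coprime) (auto dest: dvd_imp_le)
  \<comment> \<open>With the Bezout identity in this form, \<open>a\<close> steps of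
    \<open>s\<close> equal one step of \<open>k\<close> and \<open>b\<close> steps of
    \<open>k * p\<close>, without any subtraction.\<close>
  then obtain a b where "r * a = p * b + 1"
    using \<open>0 < r\<close> bezout_nat[of r p] by (auto simp: coprime_iff_gcd_eq_1 gcd.commute)
  moreover have "i + a * s = i + k * (r * a)"
    by (simp add: r(1) algebra_simps)
  ultimately have "i + a * s = (i + k) + b * (k * p)"
    by (simp add: algebra_simps)
  moreover have "Q (i + a * s) = Q i"
    using s[OF sep] by (rule periodic_add_mult)
  moreover have "Q ((i + k) + b * (k * p)) = Q (i + k)"
    using separating_length[OF sep] by (rule periodic_add_mult)
  ultimately show ?thesis
    by (simp only:)
qed

section \<open>Transfer between words of length \<open>L\<close> and polynomials\<close>

definition mask :: "nat \<Rightarrow> nat set \<Rightarrow> (nat \<Rightarrow> 'a::zero) \<Rightarrow> nat \<Rightarrow> 'a" where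
  "mask L S c = restrict (\<lambda>i. if i \<in> S then c i else 0) {..<L}"

text \<open>The reduction of \<open>q\<close> modulo \<open>x^L - 1\<close>, read as a word.\<close>

definition fold_word :: "nat \<Rightarrow> 'a::comm_monoid_add poly \<Rightarrow> nat \<Rightarrow> 'a" where
  "fold_word L q = restrict (\<lambda>t. \<Sum>i | i \<in> {..degree q} \<and> i mod L = t. coeff q i) {..<L}"

text \<open>Modulo \<open>x^L - 1\<close> each \<open>x^i\<close> equals \<open>x^(i mod L)\<close>,
  and the filter looks only at \<open>i mod L\<close>; hence filtering commutes with
  reduction.\<close>

lemma mask_fold_word_cong:
  assumes "0 < L"
  shows "monom 1 L - 1 dvd
    filter_poly (\<lambda>i. i mod L \<in> S) q - word_poly L (mask L S (fold_word L q))"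
proof -
  \<comment> \<open>The exponent map \<open>r\<close> is the identity for the filtered polynomial
    and reduction modulo \<open>L\<close> for the word, so that both can be compared term by
    term.\<close>
  let ?f = "\<lambda>r i. if i mod L \<in> S then monom (coeff q i) (r i) else 0"
  have "filter_poly (\<lambda>i. i mod L \<in> S) q = (\<Sum>i\<le>degree q. ?f (\<lambda>i. i) i)"
  proof (rule poly_eqI)
    fix n
    have "coeff (\<Sum>i\<le>degree q. ?f (\<lambda>i. i) i) n =
        (\<Sum>i\<le>degree q. if i = n then (if n mod L \<in> S then coeff q n else 0) else 0)"
      unfolding coeff_sum by (intro sum.cong) auto
    then show "coeff (filter_poly (\<lambda>i. i mod L \<in> S) q) n = coeff (\<Sum>i\<le>degree q. ?f (\<lambda>i. i) i) n"
      by (auto simp: coeff_filter_poly not_le coeff_eq_0)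
  qed
  moreover have "word_poly L (mask L S (fold_word L q)) = (\<Sum>i\<le>degree q. ?f (\<lambda>i. i mod L) i)"
  proof -
    have "word_poly L (mask L S (fold_word L q)) =
        (\<Sum>t<L. \<Sum>i | i \<in> {..degree q} \<and> i mod L = t. ?f (\<lambda>i. i mod L) i)"
      unfolding word_poly_def
    proof (intro sum.cong refl)
      fix t assume "t \<in> {..<L}"
      have "(\<Sum>i | i \<in> {..degree q} \<and> i mod L = t. ?f (\<lambda>i. i mod L) i) =
          (\<Sum>i | i \<in> {..degree q} \<and> i mod L = t. if t \<in> S then monom (coeff q i) t else 0)"
        by (intro sum.cong) auto
      then show "monom (mask L S (fold_word L q) t) t =
          (\<Sum>i | i \<in> {..degree q} \<and> i mod L = t. ?f (\<lambda>i. i mod L) i)"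
        using \<open>t \<in> {..<L}\<close>
        by (intro poly_eqI, cases "t \<in> S") (simp_all add: mask_def fold_word_def coeff_sum)
    qed
    also have "\<dots> = (\<Sum>i\<le>degree q. ?f (\<lambda>i. i mod L) i)"
      using assms by (intro sum.group) auto
    finally show ?thesis .
  qed
  ultimately have "filter_poly (\<lambda>i. i mod L \<in> S) q - word_poly L (mask L S (fold_word L q)) =
      (\<Sum>i\<le>degree q. ?f (\<lambda>i. i) i - ?f (\<lambda>i. i mod L) i)"
    by (simp add: sum_subtractf)
  moreover have "monom 1 L - 1 dvd ?f (\<lambda>i. i) i - ?f (\<lambda>i. i mod L) i" for i
  proof -
    have "monom (coeff q i) i - monom (coeff q i) (i mod L) =
        monom (coeff q i) (i mod L) * (monom 1 (L * (i div L)) - 1)"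
      by (simp add: right_diff_distrib mult_monom)
    then show ?thesis
      by (simp add: monom_diff_1_dvd)
  qed
  ultimately show ?thesis
    by (simp add: dvd_sum)
qed

text \<open>A multiple \<open>q\<close> of \<open>h\<close> is congruent to the polynomial of a
  codeword; that codeword is masked, and the congruence for \<open>S\<close> leads back to the
  filtered \<open>q\<close>.\<close>

lemma separating_of_mask:
  assumes "0 < L" and h: "h dvd monom 1 L - 1"
    and mask: "\<And>c. c \<in> cyclic_code L h \<Longrightarrow> mask L S c \<in> cyclic_code L h"
  shows "separating h (\<lambda>i. i mod L \<in> S)"
  unfolding separating_def
proof (intro allI impI)
  fix q assume "h dvd q"
  \<comment> \<open>For \<open>S = UNIV\<close> filter and mask do nothing, so the congruence
    compares \<open>q\<close> with its own reduction.\<close>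
  have eq: "filter_poly (\<lambda>i. i mod L \<in> UNIV) q = q"
    by (rule poly_eqI) (simp add: coeff_filter_poly)
  have "mask L UNIV (fold_word L q) = fold_word L q"
    by (auto simp: mask_def fold_word_def)
  then have "h dvd q - word_poly L (fold_word L q)"
    using dvd_trans[OF h mask_fold_word_cong[OF assms(1), of UNIV q]] unfolding eq by simp
  then have "h dvd q - (q - word_poly L (fold_word L q))"
    using \<open>h dvd q\<close> dvd_diff by blast
  then have "h dvd word_poly L (fold_word L q)"
    by simp
  then have "fold_word L q \<in> cyclic_code L h"
    by (simp add: mem_cyclic_code_iff[OF h] fold_word_def)
  then have "h dvd word_poly L (mask L S (fold_word L q))"
    using mask by (simp add: mem_cyclic_code_iff[OF h])
  then show "h dvd filter_poly (\<lambda>i. i mod L \<in> S) q"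
    using dvd_add[OF dvd_trans[OF h mask_fold_word_cong[OF assms(1), of S q]]] by fastforce
qed

section \<open>Automorphisms of interleaved codes\<close>

lemma carrier_Aut_code_iff:
  "\<sigma> \<in> carrier (Aut_code L C) \<longleftrightarrow>
    \<sigma> permutes {..<L} \<and> (\<forall>c\<in>C. permute_positions \<sigma> c \<in> C)"
  by (simp add: Aut_code_def)

lemma permute_positions_comp:
  assumes "\<sigma> permutes A" and "\<tau> permutes B"
  shows "permute_positions \<sigma> (permute_positions \<tau> c) = permute_positions (\<sigma> \<circ> \<tau>) c"
  using o_inv_distrib[OF permutes_bij[OF assms(1)] permutes_bij[OF assms(2)]]
  by (simp add: permute_positions_def)

lemma permute_positions_inv:
  assumes "\<sigma> permutes A"
  shows "permute_positions (inv' \<sigma>) (permute_positions \<sigma> c) = c"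
  using assms by (simp add: permute_positions_def permutes_inv_inv permutes_inverses)

lemma permute_positions_PiE:
  assumes "\<sigma> permutes A" and "c \<in> A \<rightarrow>\<^sub>E B"
  shows "permute_positions \<sigma> c \<in> A \<rightarrow>\<^sub>E B"
proof (rule PiE_I)
  fix i
  show "permute_positions \<sigma> c i \<in> B" if "i \<in> A"
    using that assms permutes_in_image[OF permutes_inv[OF assms(1)]]
    by (auto simp: permute_positions_def)
  show "permute_positions \<sigma> c i = undefined" if "i \<notin> A"
    using that assms permutes_not_in[OF permutes_inv[OF assms(1)]]
    by (auto simp: permute_positions_def)
qed

text \<open>Automorphisms are only required to map \<open>C\<close> into itself. As \<open>C\<close>
  is finite and moving positions is injective, the image is all of \<open>C\<close>.\<close>

lemma inv_in_Aut_code: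
  assumes C: "C \<subseteq> {..<L} \<rightarrow>\<^sub>E UNIV" and \<sigma>: "\<sigma> \<in> carrier (Aut_code L C)"
  shows "inv' \<sigma> \<in> carrier (Aut_code L C)"
proof -
  have perm: "\<sigma> permutes {..<L}"
    using \<sigma> by (simp add: carrier_Aut_code_iff)
  have "finite (UNIV :: bit set)"
    by (rule finite_subset[of _ "{0, 1}"]) (auto intro: bit.exhaust)
  then have "finite C"
    using C by (meson finite_PiE finite_lessThan finite_subset)
  moreover have "permute_positions \<sigma> ` C \<subseteq> C"
    using \<sigma> by (auto simp: carrier_Aut_code_iff)
  moreover have "inj_on (permute_positions \<sigma>) C"
    by (rule inj_on_inverseI[of _ "permute_positions (inv' \<sigma>)"])
      (rule permute_positions_inv[OF perm])
  ultimately have "permute_positions \<sigma> ` C = C"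
    by (rule endo_inj_surj)
  then have "permute_positions (inv' \<sigma>) c \<in> C" if "c \<in> C" for c
    using that permute_positions_inv[OF perm] by (metis imageE)
  then show ?thesis
    using permutes_inv[OF perm] by (simp add: carrier_Aut_code_iff)
qed

lemma mask_permute_positions:
  assumes "\<sigma> permutes {..<L}"
  shows "permute_positions (inv' \<sigma>) (mask L S (permute_positions \<sigma> c)) = mask L (\<sigma> -` S) c"
proof
  fix i
  have "\<sigma> i < L \<longleftrightarrow> i < L"
    using permutes_in_image[OF assms, of i] by simp
  then show "permute_positions (inv' \<sigma>) (mask L S (permute_positions \<sigma> c)) i =
      mask L (\<sigma> -` S) c i"
    using assms
    by (simp add: permute_positions_def mask_def permutes_inv_inv permutes_inverses)
qed

text \<open>Conjugating the projection to \<open>S\<close> by an automorphism gives the projection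
  to the preimage of \<open>S\<close>, so automorphisms act on the family of sets that can be
  masked.\<close>

lemma mask_Aut_code_vimage:
  assumes C: "C \<subseteq> {..<L} \<rightarrow>\<^sub>E UNIV" and \<sigma>: "\<sigma> \<in> carrier (Aut_code L C)"
    and S: "\<And>c. c \<in> C \<Longrightarrow> mask L S c \<in> C" and "c \<in> C"
  shows "mask L (\<sigma> -` S) c \<in> C"
proof -
  have perm: "\<sigma> permutes {..<L}" and "permute_positions \<sigma> c \<in> C"
    using \<sigma> \<open>c \<in> C\<close> by (auto simp: carrier_Aut_code_iff)
  then have "permute_positions (inv' \<sigma>) (mask L S (permute_positions \<sigma> c)) \<in> C"
    using S inv_in_Aut_code[OF C \<sigma>] by (auto simp: carrier_Aut_code_iff)
  then show ?thesis
    by (simp add: mask_permute_positions[OF perm])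
qed

lemma interleave_eqI:
  fixes i j k :: nat
  assumes "i mod k = j mod k" and "i div k = j div k"
  shows "i = j"
  using assms by (metis mult_div_mod_eq)

lemma mod_less_div_less:
  fixes i k M :: nat
  assumes "i < k * M"
  shows "i mod k < k" and "i div k < M"
proof -
  have "0 < k"
    using assms by (cases k) auto
  then show "i mod k < k" "i div k < M"
    using assms by (simp_all add: less_mult_imp_div_less mult.commute)
qed

text \<open>At most one strand is kept and the others become zero, which is allowed since the zero
  word belongs to \<open>D\<close>.\<close>

lemma mask_residue_interleave:
  assumes zero: "restrict (\<lambda>_. 0) {..<M} \<in> D" and c: "c \<in> interleave k M D"
  shows "mask (k * M) {i. i mod k = r} c \<in> interleave k M D"
proof -
  have "strand k M (mask (k * M) {i. i mod k = r} c) j =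
      (if j = r then strand k M c j else restrict (\<lambda>_. 0) {..<M})" if "j < k" for j
    using that by (auto simp: strand_def mask_def interleaved_index_less)
  then show ?thesis
    using c zero by (auto simp: interleave_def mask_def)
qed

text \<open>Serves both directions: wreath elements, and automorphisms permuting the residue
  classes, carry each strand \<open>j\<close> to some strand \<open>j'\<close> by a permutation
  \<open>b\<close> of its entries.\<close>

lemma strand_permute_positions:
  assumes \<sigma>: "\<sigma> permutes {..<k * M}" and b: "b permutes {..<M}"
    and step: "\<And>t. t < M \<Longrightarrow> \<sigma> (k * t + j) = k * b t + j'"
  shows "strand k M (permute_positions \<sigma> c) j' = permute_positions b (strand k M c j)"
proof
  fix s
  show "strand k M (permute_positions \<sigma> c) j' s = permute_positions b (strand k M c j) s"
  proof (cases "s < M")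
    case True
    then have t: "inv' b s < M"
      using permutes_in_image[OF permutes_inv[OF b], of s] by simp
    then have "\<sigma> (k * inv' b s + j) = k * s + j'"
      using step b by (simp add: permutes_inverses)
    then have "inv' \<sigma> (k * s + j') = k * inv' b s + j"
      using permutes_inv_eq[OF \<sigma>] by blast
    then show ?thesis
      using True t by (simp add: strand_def permute_positions_def)
  next
    case False
    then have "inv' b s = s"
      using permutes_not_in[OF permutes_inv[OF b]] by simp
    then show ?thesis
      using False by (simp add: strand_def permute_positions_def)
  qed
qed

text \<open>
  Positions of the interleaved code are \<open>k * t + j\<close> with \<open>j < k\<close>, whereas
  \<^const>\<open>power_semidirect_sym\<close> numbers the factors \<open>1, \<dots>, k\<close>; the strand \<open>j\<close>
  belongs to the factor \<open>Suc j\<close>.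
\<close>

definition wreath_perm :: "nat \<Rightarrow> nat \<Rightarrow> (nat \<Rightarrow> nat \<Rightarrow> nat) \<times> (nat \<Rightarrow> nat) \<Rightarrow> nat \<Rightarrow> nat" where
  "wreath_perm k M x i =
    (if i < k * M
     then k * fst x (snd x (Suc (i mod k))) (i div k) + (snd x (Suc (i mod k)) - 1)
     else i)"

section \<open>Elements of the wreath product as automorphisms of the interleaved code\<close>

locale wreath_element =
  fixes k M :: nat and D :: "(nat \<Rightarrow> bit) set" and a :: "nat \<Rightarrow> nat \<Rightarrow> nat" and \<tau> :: "nat \<Rightarrow> nat"
  assumes a: "a \<in> {1..k} \<rightarrow>\<^sub>E carrier (Aut_code M D)" and \<tau>: "\<tau> permutes {1..k}"
begin

lemma factor: "j < k \<Longrightarrow> a (\<tau> (Suc j)) \<in> carrier (Aut_code M D)"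
  using a permutes_in_image[OF \<tau>, of "Suc j"] by (auto simp: PiE_iff)

lemma factor_permutes: "j < k \<Longrightarrow> a (\<tau> (Suc j)) permutes {..<M}"
  using factor by (simp add: carrier_Aut_code_iff)

lemma factor_less: "j < k \<Longrightarrow> t < M \<Longrightarrow> a (\<tau> (Suc j)) t < M"
  using permutes_in_image[OF factor_permutes, of j t] by simp

text \<open>Positivity makes the truncated \<open>\<tau> (Suc j) - 1\<close> reversible, on which
  the injectivity proofs rely.\<close>

lemma strand_index: "j < k \<Longrightarrow> 0 < \<tau> (Suc j) \<and> \<tau> (Suc j) - 1 < k"
  using permutes_in_image[OF \<tau>, of "Suc j"] by auto

lemma wreath_perm_apply:
  assumes "j < k" and "t < M"
  shows "wreath_perm k M (a, \<tau>) (k * t + j) = k * a (\<tau> (Suc j)) t + (\<tau> (Suc j) - 1)"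
  using assms by (simp add: wreath_perm_def interleaved_index_less)

lemma wreath_perm_mod_div:
  assumes "i < k * M"
  shows "wreath_perm k M (a, \<tau>) i mod k = \<tau> (Suc (i mod k)) - 1"
    and "wreath_perm k M (a, \<tau>) i div k = a (\<tau> (Suc (i mod k))) (i div k)"
    and "wreath_perm k M (a, \<tau>) i < k * M"
proof -
  note lt = mod_less_div_less[OF assms]
  define r where "r = \<tau> (Suc (i mod k)) - 1"
  have "wreath_perm k M (a, \<tau>) i = k * a (\<tau> (Suc (i mod k))) (i div k) + r"
    using assms by (simp add: wreath_perm_def r_def)
  moreover have "r < k"
    using strand_index[OF lt(1)] by (simp add: r_def)
  ultimately show "wreath_perm k M (a, \<tau>) i mod k = \<tau> (Suc (i mod k)) - 1"
    "wreath_perm k M (a, \<tau>) i div k = a (\<tau> (Suc (i mod k))) (i div k)"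
    "wreath_perm k M (a, \<tau>) i < k * M"
    unfolding r_def[symmetric] using factor_less[OF lt] by (simp_all add: interleaved_index_less)
qed

lemma wreath_perm_permutes: "wreath_perm k M (a, \<tau>) permutes {..<k * M}"
proof (rule bij_imp_permutes)
  have "inj_on (wreath_perm k M (a, \<tau>)) {..<k * M}"
  proof (rule inj_onI)
    fix i j assume ij: "i \<in> {..<k * M}" "j \<in> {..<k * M}"
      and eq: "wreath_perm k M (a, \<tau>) i = wreath_perm k M (a, \<tau>) j"
    have lt: "i mod k < k" "j mod k < k"
      using ij mod_less_div_less by auto
    have "\<tau> (Suc (i mod k)) - 1 = \<tau> (Suc (j mod k)) - 1"
      using ij eq wreath_perm_mod_div(1) by (metis lessThan_iff)
    then have "\<tau> (Suc (i mod k)) = \<tau> (Suc (j mod k))"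
      using strand_index[OF lt(1)] strand_index[OF lt(2)] by linarith
    then have mod: "i mod k = j mod k"
      using permutes_inj[OF \<tau>] by (auto dest: injD)
    moreover have "a (\<tau> (Suc (i mod k))) (i div k) = a (\<tau> (Suc (i mod k))) (j div k)"
      using ij eq mod wreath_perm_mod_div(2) by (metis lessThan_iff)
    then have "i div k = j div k"
      using permutes_inj[OF factor_permutes[OF lt(1)]] by (auto dest: injD)
    ultimately show "i = j"
      by (rule interleave_eqI)
  qed
  moreover have "wreath_perm k M (a, \<tau>) ` {..<k * M} \<subseteq> {..<k * M}"
    using wreath_perm_mod_div(3) by auto
  ultimately show "bij_betw (wreath_perm k M (a, \<tau>)) {..<k * M} {..<k * M}"
    by (simp add: bij_betw_def endo_inj_surj)
qed (simp add: wreath_perm_def)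

lemma wreath_perm_in_Aut_code:
  "wreath_perm k M (a, \<tau>) \<in> carrier (Aut_code (k * M) (interleave k M D))"
  unfolding carrier_Aut_code_iff
proof (intro conjI ballI wreath_perm_permutes)
  fix c assume c: "c \<in> interleave k M D"
  have "strand k M (permute_positions (wreath_perm k M (a, \<tau>)) c) l \<in> D" if "l < k" for l
  proof -
    have "inv' \<tau> (Suc l) \<in> {1..k}"
      using permutes_in_image[OF permutes_inv[OF \<tau>], of "Suc l"] that by simp
    \<comment> \<open>\<open>j\<close> is the strand that arrives at strand
      \<open>l\<close>.\<close>
    then obtain j where j: "inv' \<tau> (Suc l) = Suc j" "j < k"
      by (cases "inv' \<tau> (Suc l)") auto
    then have l: "\<tau> (Suc j) = Suc l"
      using \<tau> by (metis permutes_inverses(1))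
    have "strand k M (permute_positions (wreath_perm k M (a, \<tau>)) c) l =
        permute_positions (a (\<tau> (Suc j))) (strand k M c j)"
      using wreath_perm_permutes factor_permutes[OF j(2)]
      by (rule strand_permute_positions) (simp add: wreath_perm_apply j(2) l)
    then show ?thesis
      using factor[OF j(2)] c j(2) by (simp add: carrier_Aut_code_iff interleave_def)
  qed
  moreover have "permute_positions (wreath_perm k M (a, \<tau>)) c \<in> {..<k * M} \<rightarrow>\<^sub>E UNIV"
    using wreath_perm_permutes c by (intro permute_positions_PiE) (auto simp: interleave_def)
  ultimately show "permute_positions (wreath_perm k M (a, \<tau>)) c \<in> interleave k M D"
    by (simp add: interleave_def)
qed

end

lemma comp_in_Aut_code:
  assumes "\<sigma> \<in> carrier (Aut_code L C)" and "\<tau> \<in> carrier (Aut_code L C)"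
  shows "\<sigma> \<circ> \<tau> \<in> carrier (Aut_code L C)"
proof -
  have perm: "\<sigma> permutes {..<L}" "\<tau> permutes {..<L}"
    using assms by (auto simp: carrier_Aut_code_iff)
  show ?thesis
    using assms permutes_compose[OF perm(2,1)]
    by (simp add: carrier_Aut_code_iff flip: permute_positions_comp[OF perm])
qed

section \<open>Multiplication in the wreath product and injectivity of its action\<close>

lemma carrier_power_semidirect_sym:
  "carrier (power_semidirect_sym A k) = ({1..k} \<rightarrow>\<^sub>E carrier A) \<times> {\<tau>. \<tau> permutes {1..k}}"
  by (simp add: power_semidirect_sym_def semidirect_product_def sym_group_def)

lemma mult_power_semidirect_sym:
  "(a, \<tau>) \<otimes>\<^bsub>power_semidirect_sym A k\<^esub> (a', \<tau>') =
    (\<lambda>i\<in>{1..k}. a i \<otimes>\<^bsub>A\<^esub> a' (inv' \<tau> i), \<tau> \<circ> \<tau>')"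
  by (simp add: power_semidirect_sym_def semidirect_product_def sym_group_def
      product_group_def permute_positions_def)

lemma mult_in_power_semidirect_sym:
  assumes "x \<in> carrier (power_semidirect_sym (Aut_code M D) k)"
    and "y \<in> carrier (power_semidirect_sym (Aut_code M D) k)"
  shows "x \<otimes>\<^bsub>power_semidirect_sym (Aut_code M D) k\<^esub> y
    \<in> carrier (power_semidirect_sym (Aut_code M D) k)"
proof -
  obtain a \<tau> a' \<tau>' where xy: "x = (a, \<tau>)" "y = (a', \<tau>')"
    by (metis surj_pair)
  have "a \<in> {1..k} \<rightarrow>\<^sub>E carrier (Aut_code M D)" and \<tau>: "\<tau> permutes {1..k}"
    and "a' \<in> {1..k} \<rightarrow>\<^sub>E carrier (Aut_code M D)" and \<tau>': "\<tau>' permutes {1..k}"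
    using assms unfolding xy carrier_power_semidirect_sym by auto
  then have "a i \<circ> a' (inv' \<tau> i) \<in> carrier (Aut_code M D)" if "i \<in> {1..k}" for i
    using that permutes_in_image[OF permutes_inv[OF \<tau>], of i]
    by (intro comp_in_Aut_code) (auto simp: PiE_iff)
  then show ?thesis
    unfolding xy mult_power_semidirect_sym carrier_power_semidirect_sym
    using permutes_compose[OF \<tau>' \<tau>] by (auto simp: Aut_code_def)
qed

text \<open>Factors are indexed by the strand of arrival. What arrives at \<open>i\<close> under
  \<open>\<tau> \<circ> \<tau>'\<close> has passed through \<open>inv' \<tau> i\<close>, where
  \<open>a' (inv' \<tau> i)\<close> acted before \<open>a i\<close>; this is the product
  formula.\<close>

lemma wreath_perm_mult:
  assumes "x \<in> carrier (power_semidirect_sym (Aut_code M D) k)"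
    and "y \<in> carrier (power_semidirect_sym (Aut_code M D) k)"
  shows "wreath_perm k M (x \<otimes>\<^bsub>power_semidirect_sym (Aut_code M D) k\<^esub> y) =
    wreath_perm k M x \<circ> wreath_perm k M y"
proof -
  obtain a \<tau> a' \<tau>' where xy: "x = (a, \<tau>)" "y = (a', \<tau>')"
    by (metis surj_pair)
  interpret x: wreath_element k M D a \<tau>
    using assms(1) unfolding xy carrier_power_semidirect_sym by unfold_locales auto
  interpret y: wreath_element k M D a' \<tau>'
    using assms(2) unfolding xy carrier_power_semidirect_sym by unfold_locales auto
  show ?thesis
    unfolding xy mult_power_semidirect_sym
  proof
    fix i
    let ?b = "\<lambda>i\<in>{1..k}. a i \<otimes>\<^bsub>Aut_code M D\<^esub> a' (inv' \<tau> i)"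
    show "wreath_perm k M (?b, \<tau> \<circ> \<tau>') i = (wreath_perm k M (a, \<tau>) \<circ> wreath_perm k M (a', \<tau>')) i"
    proof (cases "i < k * M")
      case True
      define j where "j = \<tau>' (Suc (i mod k))"
      note lt = mod_less_div_less[OF True]
      have j: "0 < j" "j - 1 < k"
        using y.strand_index[OF lt(1)] by (auto simp: j_def)
      then have "Suc (j - 1) = j" and "\<tau> j \<in> {1..k}"
        using permutes_in_image[OF x.\<tau>, of j] by auto
      moreover have "inv' \<tau> (\<tau> j) = j"
        using x.\<tau> by (simp add: permutes_inverses)
      ultimately show ?thesis
        unfolding o_apply wreath_perm_def[of k M "(a, \<tau>)"] wreath_perm_def[of k M "(?b, \<tau> \<circ> \<tau>')"]
        using y.wreath_perm_mod_div[OF True] True by (simp add: Aut_code_def flip: j_def)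
    next
      case False
      then show ?thesis
        by (simp add: wreath_perm_def)
    qed
  qed
qed

text \<open>As \<open>0 < M\<close>, each strand has a first entry, whose image reveals
  \<open>\<tau>\<close>; the quotients of all images by \<open>k\<close> then reveal
  \<open>a\<close>.\<close>

lemma inj_on_wreath_perm:
  assumes "0 < M"
  shows "inj_on (wreath_perm k M) (carrier (power_semidirect_sym (Aut_code M D) k))"
proof (rule inj_onI)
  fix x y
  assume x: "x \<in> carrier (power_semidirect_sym (Aut_code M D) k)"
    and y: "y \<in> carrier (power_semidirect_sym (Aut_code M D) k)"
    and eq: "wreath_perm k M x = wreath_perm k M y"
  obtain a \<tau> a' \<tau>' where xy: "x = (a, \<tau>)" "y = (a', \<tau>')"
    by (metis surj_pair)
  interpret x: wreath_element k M D a \<tau>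
    using x unfolding xy carrier_power_semidirect_sym by unfold_locales auto
  interpret y: wreath_element k M D a' \<tau>'
    using y unfolding xy carrier_power_semidirect_sym by unfold_locales auto
  have strands: "\<tau> (Suc j) = \<tau>' (Suc j)" if "j < k" for j
  proof -
    have "j < k * M"
      using that interleaved_index_less[of j k 0 M] assms by simp
    then have "\<tau> (Suc j) - 1 = \<tau>' (Suc j) - 1"
      using x.wreath_perm_mod_div(1)[of j] y.wreath_perm_mod_div(1)[of j] eq that
      unfolding xy by simp
    then show ?thesis
      using x.strand_index[OF that] y.strand_index[OF that] by linarith
  qed
  have "\<tau> = \<tau>'"
  proof
    fix i
    show "\<tau> i = \<tau>' i"
    proof (cases "i \<in> {1..k}")
      case True
      then show ?thesis
        using strands[of "i - 1"] by auto
    next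
      case False
      then show ?thesis
        by (metis permutes_not_in x.\<tau> y.\<tau>)
    qed
  qed
  moreover have "a = a'"
  proof (rule PiE_ext[OF x.a y.a])
    fix i assume "i \<in> {1..k}"
    then have "inv' \<tau> i \<in> {1..k}"
      using permutes_in_image[OF permutes_inv[OF x.\<tau>], of i] by simp
    then obtain j where "inv' \<tau> i = Suc j" and j: "j < k"
      by (cases "inv' \<tau> i") auto
    then have i: "i = \<tau> (Suc j)"
      using x.\<tau> by (metis permutes_inverses(1))
    show "a i = a' i"
    proof
      fix t
      show "a i t = a' i t"
      proof (cases "t < M")
        case True
        then have "k * t + j < k * M"
          using j by (simp add: interleaved_index_less)
        then show ?thesis
          using x.wreath_perm_mod_div(2)[of "k * t + j"] y.wreath_perm_mod_div(2)[of "k * t + j"]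
            eq strands[OF j] j i by (simp add: xy)
      next
        case False
        then show ?thesis
          using x.factor_permutes[OF j] y.factor_permutes[OF j] i \<open>\<tau> = \<tau>'\<close>
          by (metis lessThan_iff permutes_not_in)
      qed
    qed
  qed
  ultimately show "x = y"
    by (simp add: xy)
qed

section \<open>Permutations of the residue classes come from the wreath product\<close>

lemma strand_zero_extension:
  assumes d: "d \<in> {..<M} \<rightarrow>\<^sub>E UNIV" and "d \<in> D" and zero: "restrict (\<lambda>_. 0) {..<M} \<in> D"
    and "j < k"
  obtains c where "c \<in> interleave k M D" and "strand k M c j = d"
proof
  let ?c = "restrict (\<lambda>i. if i mod k = j then d (i div k) else 0) {..<k * M}"
  have strand: "strand k M ?c l = (if l = j then d else restrict (\<lambda>_. 0) {..<M})" if "l < k" for l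
    using that d by (auto simp: strand_def interleaved_index_less PiE_iff extensional_def)
  then show "?c \<in> interleave k M D"
    using assms by (auto simp: interleave_def)
  show "strand k M ?c j = d"
    using strand[OF \<open>j < k\<close>] by simp
qed

text \<open>\<open>\<sigma>\<close> induces a permutation of the residue classes and, from each
  class to its image, a permutation of the quotients by \<open>k\<close>. Together these form the
  preimage.\<close>

lemma block_perm_in_wreath_image:
  assumes "0 < M" and D: "D \<subseteq> {..<M} \<rightarrow>\<^sub>E UNIV" and zero: "restrict (\<lambda>_. 0) {..<M} \<in> D"
    and \<sigma>: "\<sigma> \<in> carrier (Aut_code (k * M) (interleave k M D))"
    and blocks: "\<And>i j. i < k * M \<Longrightarrow> j < k * M \<Longrightarrow> \<sigma> i mod k = \<sigma> j mod k \<longleftrightarrow> i mod k = j mod k"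
  shows "\<sigma> \<in> wreath_perm k M ` carrier (power_semidirect_sym (Aut_code M D) k)"
proof -
  have perm: "\<sigma> permutes {..<k * M}"
    using \<sigma> by (simp add: carrier_Aut_code_iff)
  have less: "\<sigma> i < k * M" if "i < k * M" for i
    using permutes_in_image[OF perm, of i] that by simp
  have first: "j < k * M" if "j < k" for j
    using that interleaved_index_less[of j k 0 M] \<open>0 < M\<close> by simp
  \<comment> \<open>Read off at the first entry of each strand, position \<open>i - 1\<close>; by
    \<open>blocks\<close> every other entry of the strand gives the same class.\<close>
  define \<tau> where "\<tau> i = (if i \<in> {1..k} then Suc (\<sigma> (i - 1) mod k) else i)" for i
  have \<tau>_Suc: "\<tau> (Suc j) = Suc (\<sigma> j mod k)" if "j < k" for j
    using that by (simp add: \<tau>_def)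
  have \<tau>: "\<tau> permutes {1..k}"
  proof (rule bij_imp_permutes)
    have "inj_on \<tau> {1..k}"
    proof (rule inj_onI)
      fix i j assume ij: "i \<in> {1..k}" "j \<in> {1..k}" and "\<tau> i = \<tau> j"
      then have "\<sigma> (i - 1) mod k = \<sigma> (j - 1) mod k"
        by (simp add: \<tau>_def)
      then have "(i - 1) mod k = (j - 1) mod k"
        using blocks[of "i - 1" "j - 1"] first[of "i - 1"] first[of "j - 1"] ij by auto
      then show "i = j"
        using ij by auto
    qed
    moreover have "\<tau> ` {1..k} \<subseteq> {1..k}"
      by (auto simp: \<tau>_def Suc_le_eq)
    ultimately show "bij_betw \<tau> {1..k} {1..k}"
      by (simp add: bij_betw_def endo_inj_surj)
  qed (auto simp: \<tau>_def)
  \<comment> \<open>Index \<open>i\<close> is the strand of arrival, so the source strand is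
    \<open>inv' \<tau> i - 1\<close>; the value \<open>t\<close> outside the range is what
    \<open>permutes\<close> demands.\<close>
  define b where "b i t = (if t < M then \<sigma> (k * t + (inv' \<tau> i - 1)) div k else t)" for i t
  have b: "\<sigma> (k * t + j) = k * b (\<tau> (Suc j)) t + (\<tau> (Suc j) - 1)" if "j < k" "t < M" for j t
  proof -
    have "\<sigma> (k * t + j) mod k = \<sigma> j mod k"
      using blocks[of "k * t + j" j] first[OF that(1)] that by (simp add: interleaved_index_less)
    moreover have "b (\<tau> (Suc j)) t = \<sigma> (k * t + j) div k"
      using that \<tau> by (simp add: b_def permutes_inverses)
    ultimately show ?thesis
      using that(1) by (simp add: \<tau>_Suc) (metis mult_div_mod_eq)
  qed
  have "b i \<in> carrier (Aut_code M D)" if i: "i \<in> {1..k}" for i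
  proof -
    have "inv' \<tau> i \<in> {1..k}"
      using permutes_in_image[OF permutes_inv[OF \<tau>], of i] i by simp
    then obtain j where "inv' \<tau> i = Suc j" and j: "j < k"
      by (cases "inv' \<tau> i") auto
    then have i: "i = \<tau> (Suc j)"
      using \<tau> by (metis permutes_inverses(1))
    have step: "\<sigma> (k * t + j) = k * b i t + (i - 1)" if "t < M" for t
      using b[OF j that] i by simp
    have "i - 1 < k"
      using \<open>i \<in> {1..k}\<close> by auto
    have b_permutes: "b i permutes {..<M}"
    proof (rule bij_imp_permutes)
      have "inj_on (b i) {..<M}"
      proof (rule inj_onI)
        fix s t assume st: "s \<in> {..<M}" "t \<in> {..<M}" and "b i s = b i t"
        then have "\<sigma> (k * s + j) = \<sigma> (k * t + j)"
          using step by simp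
        then have "k * s + j = k * t + j"
          by (rule injD[OF permutes_inj[OF perm]])
        then show "s = t"
          using j by simp
      qed
      moreover have "b i t < M" if "t < M" for t
        using less[of "k * t + j"] step[OF that] that j \<open>i - 1 < k\<close>
        by (simp add: interleaved_index_less)
      then have "b i ` {..<M} \<subseteq> {..<M}"
        by auto
      ultimately show "bij_betw (b i) {..<M} {..<M}"
        by (simp add: bij_betw_def endo_inj_surj)
    qed (simp add: b_def)
    moreover have "permute_positions (b i) d \<in> D" if "d \<in> D" for d
    proof -
      have "d \<in> {..<M} \<rightarrow>\<^sub>E UNIV"
        using D that by blast
      \<comment> \<open>Testing \<open>\<sigma>\<close> on a word with strand \<open>j\<close> equal
        to \<open>d\<close> isolates the action of \<open>b i\<close> on \<open>d\<close>.\<close>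
      then obtain c where c: "c \<in> interleave k M D" and "strand k M c j = d"
        using \<open>d \<in> D\<close> zero j by (rule strand_zero_extension)
      then have "strand k M (permute_positions \<sigma> c) (i - 1) = permute_positions (b i) d"
        using strand_permute_positions[OF perm b_permutes step, where c = c] by simp
      moreover have "permute_positions \<sigma> c \<in> interleave k M D"
        using \<sigma> c by (simp add: carrier_Aut_code_iff)
      ultimately show ?thesis
        using \<open>i - 1 < k\<close> by (auto simp: interleave_def)
    qed
    ultimately show ?thesis
      by (simp add: carrier_Aut_code_iff)
  qed
  then have mem: "(restrict b {1..k}, \<tau>) \<in> carrier (power_semidirect_sym (Aut_code M D) k)"
    using \<tau> by (simp add: carrier_power_semidirect_sym)
  have "wreath_perm k M (restrict b {1..k}, \<tau>) = \<sigma>"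
  proof
    fix i
    show "wreath_perm k M (restrict b {1..k}, \<tau>) i = \<sigma> i"
    proof (cases "i < k * M")
      case True
      note lt = mod_less_div_less[OF True]
      have "\<tau> (Suc (i mod k)) \<in> {1..k}"
        using permutes_in_image[OF \<tau>, of "Suc (i mod k)"] lt(1) by simp
      then show ?thesis
        using b[OF lt] True by (simp add: wreath_perm_def)
    next
      case False
      then show ?thesis
        using permutes_not_in[OF perm] by (simp add: wreath_perm_def)
    qed
  qed
  with mem show ?thesis
    by (metis image_eqI)
qed

text \<open>All information about the particular code enters through \<open>blocks\<close>: sets
  that can be masked are unions of residue classes. Preimages of residue classes under automorphisms
  are such sets, so automorphisms permute the classes.\<close>

lemma Aut_code_interleave_iso:
  assumes "0 < M" and D: "D \<subseteq> {..<M} \<rightarrow>\<^sub>E UNIV" and zero: "restrict (\<lambda>_. 0) {..<M} \<in> D"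
    and blocks: "\<And>S i j. (\<And>c. c \<in> interleave k M D \<Longrightarrow> mask (k * M) S c \<in> interleave k M D) \<Longrightarrow>
      i < k * M \<Longrightarrow> j < k * M \<Longrightarrow> i mod k = j mod k \<Longrightarrow> i \<in> S \<longleftrightarrow> j \<in> S"
  shows "Aut_code (k * M) (interleave k M D) \<cong> power_semidirect_sym (Aut_code M D) k"
proof -
  let ?C = "interleave k M D"
  let ?A = "Aut_code (k * M) ?C" and ?W = "power_semidirect_sym (Aut_code M D) k"
  have C: "?C \<subseteq> {..<k * M} \<rightarrow>\<^sub>E UNIV"
    by (auto simp: interleave_def)
  have Aut_mod: "\<sigma> i mod k = \<sigma> j mod k"
    if \<sigma>: "\<sigma> \<in> carrier ?A" and "i < k * M" "j < k * M" "i mod k = j mod k" for \<sigma> i j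
  proof -
    \<comment> \<open>The class of \<open>\<sigma> i\<close> can be masked, hence so can its
      preimage, which contains \<open>i\<close> and therefore \<open>j\<close>.\<close>
    have "i \<in> \<sigma> -` {l. l mod k = \<sigma> i mod k} \<longleftrightarrow> j \<in> \<sigma> -` {l. l mod k = \<sigma> i mod k}"
      using mask_Aut_code_vimage[OF C \<sigma> mask_residue_interleave[OF zero]]
      by (rule blocks[OF _ that(2-4)])
    then show ?thesis
      by simp
  qed
  have Aut_mod_iff: "\<sigma> i mod k = \<sigma> j mod k \<longleftrightarrow> i mod k = j mod k"
    if \<sigma>: "\<sigma> \<in> carrier ?A" and "i < k * M" "j < k * M" for \<sigma> i j
  proof
    have perm: "\<sigma> permutes {..<k * M}"
      using \<sigma> by (simp add: carrier_Aut_code_iff)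
    assume "\<sigma> i mod k = \<sigma> j mod k"
    \<comment> \<open>The converse is the same fact for the inverse automorphism.\<close>
    then have "inv' \<sigma> (\<sigma> i) mod k = inv' \<sigma> (\<sigma> j) mod k"
      using permutes_in_image[OF perm] that by (intro Aut_mod[OF inv_in_Aut_code[OF C \<sigma>]]) auto
    then show "i mod k = j mod k"
      using perm by (simp add: permutes_inverses)
  qed (rule Aut_mod[OF that])
  have "bij_betw (wreath_perm k M) (carrier ?W) (carrier ?A)"
    unfolding bij_betw_def
  proof (intro conjI inj_on_wreath_perm \<open>0 < M\<close> equalityI subsetI)
    fix \<sigma> assume "\<sigma> \<in> wreath_perm k M ` carrier ?W"
    then obtain a \<tau> where "\<sigma> = wreath_perm k M (a, \<tau>)" "wreath_element k M D a \<tau>"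
      by (auto simp: carrier_power_semidirect_sym wreath_element_def)
    then show "\<sigma> \<in> carrier ?A"
      using wreath_element.wreath_perm_in_Aut_code by blast
  next
    fix \<sigma> assume "\<sigma> \<in> carrier ?A"
    then show "\<sigma> \<in> wreath_perm k M ` carrier ?W"
      using block_perm_in_wreath_image[OF \<open>0 < M\<close> D zero] Aut_mod_iff by blast
  qed
  note bij = this
  \<comment> \<open>Multiplicativity is known for \<open>wreath_perm\<close>, so the isomorphism
    from \<open>?A\<close> is taken to be its inverse.\<close>
  let ?h = "inv_into (carrier ?W) (wreath_perm k M)"
  have "?h \<in> iso ?A ?W"
    unfolding iso_def
  proof (intro CollectI conjI bij_betw_inv_into[OF bij] homI)
    fix \<sigma> assume \<sigma>: "\<sigma> \<in> carrier ?A"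
    show "?h \<sigma> \<in> carrier ?W"
      using bij_betw_apply[OF bij_betw_inv_into[OF bij] \<sigma>] .
    fix \<sigma>' assume \<sigma>': "\<sigma>' \<in> carrier ?A"
    have mem: "?h \<sigma> \<in> carrier ?W" "?h \<sigma>' \<in> carrier ?W"
      using bij_betw_apply[OF bij_betw_inv_into[OF bij]] \<sigma> \<sigma>' by blast+
    have "wreath_perm k M (?h \<sigma> \<otimes>\<^bsub>?W\<^esub> ?h \<sigma>') = \<sigma> \<otimes>\<^bsub>?A\<^esub> \<sigma>'"
      using wreath_perm_mult[OF mem] bij_betw_inv_into_right[OF bij] \<sigma> \<sigma>'
      by (simp add: Aut_code_def)
    then show "?h (\<sigma> \<otimes>\<^bsub>?A\<^esub> \<sigma>') = ?h \<sigma> \<otimes>\<^bsub>?W\<^esub> ?h \<sigma>'"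
      using bij_betw_inv_into_left[OF bij mult_in_power_semidirect_sym[OF mem]] by metis
  qed
  then show ?thesis
    by (rule is_isoI)
qed

section \<open>Application to the codes generated by \<open>g(x^(p^m))\<close>\<close>

theorem theorem5p2:
  fixes p n m :: nat and g :: "bit poly"
  assumes "prime p" and "p \<noteq> 2" and "n \<ge> 1"
    and "irreducible g" and "g dvd (\<Sum>k<p. monom 1 k)"
    and "1 \<le> m" and "m \<le> n - 1"
  shows "Aut_code (p ^ n) (code_C g p n m) \<cong>
    power_semidirect_sym (Aut_code (p ^ (n - m)) (code_C g p (n - m) 0)) (p ^ m)"
proof -
  define k M where "k = p ^ m" and "M = p ^ (n - m)"
  have "0 < p"
    using assms(1) by (rule prime_gt_0_nat)
  then have "0 < k" "0 < M"
    by (simp_all add: k_def M_def)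
  have length: "p ^ n = k * M"
    using assms(3,7) by (simp add: k_def M_def flip: power_add)
  let ?f = "\<Sum>k<p. monom 1 k :: bit poly"
  have "monom 1 p - 1 = (monom 1 1 - 1) * ?f"
    using power_diff_1_eq[of "monom 1 1 :: bit poly" p] by (simp add: monom_power)
  then have g_dvd: "g dvd monom 1 p - 1"
    using assms(5) by simp
  \<comment> \<open>Because \<open>m < n\<close>, \<open>p\<close> divides \<open>M\<close>, so
    \<open>x^p - 1\<close> divides \<open>x^M - 1\<close>.\<close>
  moreover have "n - m = Suc (n - m - 1)"
    using assms(3,7) by simp
  then have "M = p * p ^ (n - m - 1)"
    unfolding M_def by (metis power_Suc)
  ultimately have g_dvd_M: "g dvd monom 1 M - 1"
    using monom_diff_1_dvd[of p "p ^ (n - m - 1)", where ?'a = bit] dvd_trans by blast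
  have coeff_f: "coeff ?f i = (if i < p then 1 else 0)" for i
    by (simp add: coeff_sum)
  have "?f \<noteq> 0"
    using coeff_f[of 0] \<open>0 < p\<close> by (metis coeff_0 zero_neq_one)
  then have "degree g \<le> degree ?f"
    using assms(5) by (rule dvd_imp_degree_le[rotated])
  also have "degree ?f \<le> p - 1"
    by (rule degree_le) (auto simp: coeff_f)
  finally have "degree g < p"
    using \<open>0 < p\<close> by linarith
  \<comment> \<open>The constant term of \<open>?f\<close> is \<open>1\<close>, and that of
    \<open>g\<close> divides it.\<close>
  have "coeff g 0 \<noteq> 0"
  proof -
    obtain q where "?f = g * q"
      using assms(5) by (elim dvdE)
    then have "coeff g 0 * coeff q 0 = 1"
      using coeff_f[of 0] \<open>0 < p\<close> by (simp add: coeff_mult_0)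
    then show ?thesis
      by auto
  qed
  have "\<not> g dvd 1"
    using assms(4) by (rule irreducible_not_unit)
  define D where "D = cyclic_code M g"
  have D: "code_C g p (n - m) 0 = D"
  proof -
    have "monom 1 1 = [:0, 1 :: bit:]"
      by (metis One_nat_def monom_0 monom_Suc)
    then show ?thesis
      by (simp add: code_C_def D_def M_def)
  qed
  have C: "code_C g p n m = interleave k M D"
    using cyclic_code_pcompose[OF \<open>0 < k\<close> g_dvd_M] by (simp add: code_C_def length D_def flip: k_def)
  have "Aut_code (k * M) (interleave k M D) \<cong> power_semidirect_sym (Aut_code M D) k"
  proof (rule Aut_code_interleave_iso[OF \<open>0 < M\<close>])
    show "D \<subseteq> {..<M} \<rightarrow>\<^sub>E UNIV"
      by (auto simp: D_def cyclic_code_def)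
    have "word_poly M (restrict (\<lambda>_. 0) {..<M}) = 0"
      by (rule poly_eqI) (simp add: coeff_word_poly)
    then show "restrict (\<lambda>_. 0) {..<M} \<in> D"
      by (simp add: D_def mem_cyclic_code_iff[OF g_dvd_M])
  next
    fix S i j
    assume mask: "\<And>c. c \<in> interleave k M D \<Longrightarrow> mask (k * M) S c \<in> interleave k M D"
      and ij: "i < k * M" "j < k * M" "i mod k = j mod k"
    \<comment> \<open>Membership in \<open>S\<close> is extended periodically to all exponents, as
      \<open>separating\<close> requires.\<close>
    let ?Q = "\<lambda>i. i mod (k * M) \<in> S"
    have "separating (pcompose g (monom 1 k)) ?Q"
      using mask \<open>0 < k\<close> \<open>0 < M\<close> cyclic_code_pcompose[OF \<open>0 < k\<close> g_dvd_M]
      by (intro separating_of_mask pcompose_dvd_monom_diff_1 g_dvd_M) (simp_all add: D_def)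
    then have "?Q (l + k) = ?Q l" for l
      by (rule separating_pcompose_period[OF assms(1) \<open>0 < k\<close> \<open>degree g < p\<close>
            \<open>coeff g 0 \<noteq> 0\<close> \<open>\<not> g dvd 1\<close> g_dvd])
    then have "?Q (l mod k + l div k * k) = ?Q (l mod k)" for l
      by (rule periodic_add_mult)
    then have "?Q l = ?Q (l mod k)" for l
      by simp
    then have "?Q i = ?Q j"
      using ij(3) by metis
    then show "i \<in> S \<longleftrightarrow> j \<in> S"
      using ij by simp
  qed
  then show ?thesis
    by (simp only: length C D flip: k_def M_def)
qed

end
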